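(* Let $C$ be a closed convex cone in $H$, $K$ a nonempty closed convex subset of $H$, and let $f:C\to H$ and $g:H\to H$ be weakly homogeneous mappings of degrees $\delta_1>0$ and $\delta_2>0$, respectively, with leading terms $f^\infty$ and $g^\infty$. Suppose that $g$ is an injective mapping, $g^{-1}(K)\subseteq C$, and for any $y\in K$ there exists an $x\in H$ such that $g(x)=y$. If the following conditions hold: (i) $f$ is strictly monotone with respect to $g$ on $K$; and (ii) $\langle f^\infty(x),g^\infty(x)\rangle\ne 0$ for any $x\in C$ with $\|x\|=1$ and $g^\infty(x)\in K^\infty$, then WHGVI$(f,g,K)$ has a unique solution.
   Context: $H$ is a finite dimensional real Hilbert space with inner product $\langle\cdot,\cdot\rangle$ and norm $\|\cdot\|$; $g^{-1}(K)=\{x\in H\mid g(x)\in K\}$. Weakly homogeneous mappings: let $D\subseteq H$ be a closed convex cone ($D=C$ for $f$, $D=H$ for $g$). A continuous $h:D\to H$ is positively homogeneous of degree $\delta$ if $h(\lambda x)=\lambda^\delta h(x)$ for all $x\in D$, $\lambda>0$. A mapping $\varphi:D\to H$ is weakly homogeneous of degree $\delta>0$ if $\varphi=h+e$ with $h$ positively homogeneous of degree $\delta$ and $e:D\to H$ continuous with $e(x)/\|x\|^\delta\to0$ as $\|x\|\to\infty$ in $D$. Then $h$ is uniquely determined; it is called the leading term of $\varphi$ and denoted $\varphi^\infty$. Recession cone: $K^\infty:=\{u\in H\mid \exists t_k\to\infty,\ \exists x^k\in K \text{ such that } x^k/t_k\to u\}$. WHGVI$(f,g,K)$ is the problem of finding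 $x^*\in H$ such that $g(x^* )\in K$ and $\langle f(x^* ),y-g(x^* )\rangle\ge0$ for all $y\in K$. $f$ is strictly monotone with respect to $g$ on $K$ if $g(x),g(y)\in K$ and $x\ne y$ imply $\langle f(x)-f(y),g(x)-g(y)\rangle>0$. *)

theory Defs
  imports "HOL-Analysis.Analysis"
begin

text \<open>
  A mapping with domain \<open>D\<close> is a total function of which only the values on \<open>D\<close> matter.
\<close>

definition pos_homogeneous_on :: "'a::real_normed_vector set \<Rightarrow> real \<Rightarrow> ('a \<Rightarrow> 'a) \<Rightarrow> bool"
  where "pos_homogeneous_on D \<delta> h \<longleftrightarrow>
    continuous_on D h \<and>
    (\<forall>x\<in>D. \<forall>s>0. h (s *\<^sub>R x) = (s powr \<delta>) *\<^sub>R h x)"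

definition is_leading_term ::
    "'a::real_normed_vector set \<Rightarrow> real \<Rightarrow> ('a \<Rightarrow> 'a) \<Rightarrow> ('a \<Rightarrow> 'a) \<Rightarrow> bool"
  where "is_leading_term D \<delta> \<phi> h \<longleftrightarrow>
    pos_homogeneous_on D \<delta> h \<and>
    (\<exists>e. continuous_on D e \<and>
         ((\<lambda>x. e x /\<^sub>R (norm x powr \<delta>)) \<longlongrightarrow> 0) (inf at_infinity (principal D)) \<and>
         (\<forall>x\<in>D. \<phi> x = h x + e x))"

definition weakly_homogeneous_on ::
    "'a::real_normed_vector set \<Rightarrow> real \<Rightarrow> ('a \<Rightarrow> 'a) \<Rightarrow> bool"
  where "weakly_homogeneous_on D \<delta> \<phi> \<longleftrightarrow> \<delta> > 0 \<and> (\<exists>h. is_leading_term D \<delta> \<phi> h)"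

text \<open>The leading term is determined by the mapping, as a mapping on \<open>D\<close>.\<close>

lemma is_leading_term_unique:
  fixes D :: "'a::real_normed_vector set"
  assumes D: "cone D"
    and h: "is_leading_term D \<delta> \<phi> h" and h': "is_leading_term D \<delta> \<phi> h'"
    and \<delta>: "\<delta> > 0" and x: "x \<in> D"
  shows "h x = h' x"
proof (cases "x = 0")
  case True
  have *: "k 0 = 0" if "is_leading_term D \<delta> \<phi> k" for k :: "'a \<Rightarrow> 'a"
  proof -
    have "\<forall>s>0. k (s *\<^sub>R 0) = (s powr \<delta>) *\<^sub>R k 0"
      using that x True unfolding is_leading_term_def pos_homogeneous_on_def by blast
    then have "k 0 = (2 powr \<delta>) *\<^sub>R k 0"
      by (metis scaleR_zero_right zero_less_numeral)
    moreover have "2 powr \<delta> \<noteq> (1::real)"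
      using \<delta> by (metis gr_one_powr less_irrefl one_less_numeral_iff semiring_norm(76))
    ultimately show ?thesis
      by (metis scaleR_cancel_right scaleR_one)
  qed
  show ?thesis
    using *[OF h] *[OF h'] True by simp
next
  case False
  obtain e where e: "((\<lambda>x. e x /\<^sub>R (norm x powr \<delta>)) \<longlongrightarrow> 0) (inf at_infinity (principal D))"
      "\<forall>x\<in>D. \<phi> x = h x + e x"
    using h unfolding is_leading_term_def by blast
  obtain e' where e': "((\<lambda>x. e' x /\<^sub>R (norm x powr \<delta>)) \<longlongrightarrow> 0) (inf at_infinity (principal D))"
      "\<forall>x\<in>D. \<phi> x = h' x + e' x"
    using h' unfolding is_leading_term_def by blast
  let ?r = "\<lambda>t::real. t *\<^sub>R x"
  have "filterlim ?r at_infinity at_top"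
    unfolding filterlim_at_infinity[OF order_refl]
  proof (intro allI impI)
    fix r :: real
    assume "r > 0"
    show "\<forall>\<^sub>F t in at_top. r \<le> norm (?r t)"
      using eventually_ge_at_top[of "r / norm x"] eventually_ge_at_top[of 0]
      by eventually_elim (use False in \<open>simp add: field_simps\<close>)
  qed
  moreover have "\<forall>\<^sub>F t in at_top. ?r t \<in> D"
    using eventually_ge_at_top[of 0] by eventually_elim (use D x in \<open>simp add: mem_cone\<close>)
  ultimately have r: "filterlim ?r (inf at_infinity (principal D)) at_top"
    by (simp add: filterlim_inf filterlim_principal)
  have "((\<lambda>t. e' (?r t) /\<^sub>R (norm (?r t) powr \<delta>) - e (?r t) /\<^sub>R (norm (?r t) powr \<delta>))
      \<longlongrightarrow> 0 - 0) at_top"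
    by (intro tendsto_diff filterlim_compose[OF e(1) r] filterlim_compose[OF e'(1) r])
  moreover have "\<forall>\<^sub>F t in at_top.
      e' (?r t) /\<^sub>R (norm (?r t) powr \<delta>) - e (?r t) /\<^sub>R (norm (?r t) powr \<delta>)
      = (h x - h' x) /\<^sub>R (norm x powr \<delta>)"
    using eventually_gt_at_top[of 0]
  proof eventually_elim
    case (elim t)
    have "?r t \<in> D"
      using D x elim by (simp add: mem_cone)
    then have "e' (?r t) - e (?r t) = h (?r t) - h' (?r t)"
      using e(2) e'(2) by (metis add_diff_cancel_left' add_diff_eq diff_add_eq_diff_diff_swap diff_diff_eq2)
    also have "\<dots> = (t powr \<delta>) *\<^sub>R (h x - h' x)"
      using h h' x elim unfolding is_leading_term_def pos_homogeneous_on_def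
      by (simp add: scaleR_diff_right)
    finally have "e' (?r t) - e (?r t) = (t powr \<delta>) *\<^sub>R (h x - h' x)" .
    then show ?case
      using elim by (simp add: powr_mult flip: scaleR_diff_right)
  qed
  ultimately have "((\<lambda>t::real. (h x - h' x) /\<^sub>R (norm x powr \<delta>)) \<longlongrightarrow> 0) at_top"
    by (simp cong: filterlim_cong add: tendsto_cong)
  then have "(h x - h' x) /\<^sub>R (norm x powr \<delta>) = 0"
    by (simp add: tendsto_const_iff)
  then show ?thesis
    using False by simp
qed

definition recession_cone :: "'a::real_normed_vector set \<Rightarrow> 'a set"
  where "recession_cone K =
    {u. \<exists>(t :: nat \<Rightarrow> real) x. filterlim t at_top sequentially \<and>
          (\<forall>k. x k \<in> K) \<and> (\<lambda>k. x k /\<^sub>R t k) \<longlonglongrightarrow> u}"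

definition whgvi_solution ::
    "('a::real_inner \<Rightarrow> 'a) \<Rightarrow> ('a \<Rightarrow> 'a) \<Rightarrow> 'a set \<Rightarrow> 'a \<Rightarrow> bool"
  where "whgvi_solution f g K x \<longleftrightarrow>
    g x \<in> K \<and> (\<forall>y\<in>K. inner (f x) (y - g x) \<ge> 0)"

definition strictly_monotone_wrt ::
    "('a::real_inner \<Rightarrow> 'a) \<Rightarrow> ('a \<Rightarrow> 'a) \<Rightarrow> 'a set \<Rightarrow> bool"
  where "strictly_monotone_wrt f g K \<longleftrightarrow>
    (\<forall>x y. g x \<in> K \<and> g y \<in> K \<and> x \<noteq> y \<longrightarrow> inner (f x - f y) (g x - g y) > 0)"

end

theory Submission
  imports Defs
begin

text \<open>
  By invariance of domain the injective continuous map \<open>g\<close> has a continuous inverse on its range, so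
  the problem is the variational inequality for \<open>f \<circ> g\<inverse>\<close> on \<open>K\<close>, which Brouwer's theorem solves on
  every truncation of \<open>K\<close> by a ball around some \<open>g q \<in> K\<close>. A solution of a truncated problem in the
  open ball solves the whole problem. If this never happens, the solutions \<open>x\<^sub>n\<close> of the truncated
  problems are unbounded; let \<open>u\<close> be a limit point of \<open>x\<^sub>n / \<parallel>x\<^sub>n\<parallel>\<close>. Rescaling the truncated
  inequality at \<open>g q\<close> gives \<open>\<langle>f\<^sup>\<infinity> u, g\<^sup>\<infinity> u\<rangle> \<le> 0\<close>, and rescaling the monotonicity inequality between
  \<open>x\<^sub>n\<close> and \<open>q\<close> gives \<open>\<langle>f\<^sup>\<infinity> u, g\<^sup>\<infinity> u\<rangle> \<ge> 0\<close>, which contradicts (ii).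
\<close>

text \<open>The solutions are the fixed points of \<open>?P\<close>: if \<open>y\<close> is the
  projection of \<open>y - F y\<close> onto \<open>S\<close>, then the residual \<open>- F y\<close>
  makes a non-acute angle with every \<open>z - y\<close>. Brouwer's theorem supplies such a
  \<open>y\<close>.\<close>

lemma variational_inequality_compact:
  fixes F :: "'a::euclidean_space \<Rightarrow> 'a"
  assumes S: "compact S" "convex S" "S \<noteq> {}" and F: "continuous_on S F"
  obtains y where "y \<in> S" "\<And>z. z \<in> S \<Longrightarrow> inner (F y) (z - y) \<ge> 0"
proof -
  let ?P = "\<lambda>y. closest_point S (y - F y)"
  have "closed S"
    using S(1) by (rule compact_imp_closed)
  have "continuous_on S ?P"
    by (rule continuous_on_compose2[OF continuous_on_closest_point[OF S(2) \<open>closed S\<close> S(3), of UNIV]])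
      (auto intro!: continuous_intros F)
  moreover have "?P \<in> S \<rightarrow> S"
    using closest_point_in_set[OF \<open>closed S\<close> S(3)] by blast
  ultimately obtain y where y: "y \<in> S" "?P y = y"
    by (rule brouwer[OF S])
  have "inner (F y) (z - y) \<ge> 0" if "z \<in> S" for z
    using closest_point_dot[OF S(2) \<open>closed S\<close> that, of "y - F y"] y(2) by simp
  with y(1) show thesis
    by (rule that)
qed

text \<open>As \<open>y\<close> is strictly inside the ball, a short step from \<open>y\<close>
  towards \<open>z\<close> stays in the ball, and in \<open>K\<close> by convexity. Testing there
  gives a positive multiple of the wanted inner product.\<close>

lemma variational_inequality_local_imp_global:
  fixes K :: "'a::real_inner set"
  assumes K: "convex K" and y: "y \<in> K" "dist p y < R" and z: "z \<in> K"
    and local: "\<And>w. w \<in> K \<inter> cball p R \<Longrightarrow> inner v (w - y) \<ge> 0"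
  shows "inner v (z - y) \<ge> 0"
proof -
  have "((\<lambda>t::real. dist p (y + t *\<^sub>R (z - y))) \<longlongrightarrow> dist p (y + 0 *\<^sub>R (z - y))) (at_right 0)"
    by (intro tendsto_intros)
  then have "\<forall>\<^sub>F t::real in at_right 0. dist p (y + t *\<^sub>R (z - y)) < R"
    using y(2) by (intro order_tendstoD(2)) auto
  moreover have "\<forall>\<^sub>F t::real in at_right 0. 0 < t \<and> t < 1"
    using eventually_at_right_real[of 0 "1::real"] by simp
  ultimately have "\<forall>\<^sub>F t::real in at_right 0. dist p (y + t *\<^sub>R (z - y)) < R \<and> 0 < t \<and> t < 1"
    by eventually_elim simp
  then obtain t :: real where t: "dist p (y + t *\<^sub>R (z - y)) < R" "0 < t" "t < 1"
    using eventually_happens'[OF trivial_limit_at_right_real] by blast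
  have "y + t *\<^sub>R (z - y) = (1 - t) *\<^sub>R y + t *\<^sub>R z"
    by (simp add: algebra_simps)
  then have "y + t *\<^sub>R (z - y) \<in> K"
    using K y(1) z t by (simp add: convexD)
  then have "0 \<le> t * inner v (z - y)"
    using local[of "y + t *\<^sub>R (z - y)"] t by simp
  then show ?thesis
    using t(2) by (simp add: zero_le_mult_iff)
qed

lemma leading_term_continuous_on:
  assumes "is_leading_term D \<delta> \<phi> h"
  shows "continuous_on D \<phi>"
proof -
  obtain e where "continuous_on D h" "continuous_on D e" and eq: "\<forall>x\<in>D. \<phi> x = h x + e x"
    using assms unfolding is_leading_term_def pos_homogeneous_on_def by blast
  then have "continuous_on D (\<lambda>x. h x + e x)"
    by (intro continuous_intros)
  then show ?thesis
    using eq continuous_on_cong[of D D \<phi> "\<lambda>x. h x + e x"] by simp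
qed

text \<open>Homogeneity turns the scaled leading part into \<open>h\<close> at the normalized point,
  where continuity on \<open>D\<close> gives the limit \<open>h u\<close>; the scaled error
  vanishes.\<close>

lemma leading_term_tendsto:
  assumes D: "cone D" and lt: "is_leading_term D \<delta> \<phi> h"
    and x: "filterlim x at_infinity F" "\<And>n. x n \<in> D"
    and u: "((\<lambda>n. x n /\<^sub>R norm (x n)) \<longlongrightarrow> u) F" "u \<in> D"
  shows "((\<lambda>n. \<phi> (x n) /\<^sub>R (norm (x n) powr \<delta>)) \<longlongrightarrow> h u) F"
proof -
  obtain e where h: "continuous_on D h" "\<And>x s. x \<in> D \<Longrightarrow> s > 0 \<Longrightarrow> h (s *\<^sub>R x) = (s powr \<delta>) *\<^sub>R h x"
    and e: "((\<lambda>x. e x /\<^sub>R (norm x powr \<delta>)) \<longlongrightarrow> 0) (inf at_infinity (principal D))"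
    and eq: "\<And>x. x \<in> D \<Longrightarrow> \<phi> x = h x + e x"
    using lt unfolding is_leading_term_def pos_homogeneous_on_def by metis
  \<comment> \<open>If \<open>x n = 0\<close>, the quotient is 0 by convention, which still lies in
    the cone.\<close>
  have inD: "x n /\<^sub>R norm (x n) \<in> D" for n
    using D x(2) by (simp add: mem_cone)
  have "filterlim x (inf at_infinity (principal D)) F"
    using x by (simp add: filterlim_inf filterlim_principal)
  then have "((\<lambda>n. e (x n) /\<^sub>R (norm (x n) powr \<delta>)) \<longlongrightarrow> 0) F"
    by (rule filterlim_compose[OF e])
  moreover have "((\<lambda>n. h (x n /\<^sub>R norm (x n))) \<longlongrightarrow> h u) F"
    using continuous_on_tendsto_compose[OF h(1) u] inD by simp
  ultimately have "((\<lambda>n. h (x n /\<^sub>R norm (x n)) + e (x n) /\<^sub>R (norm (x n) powr \<delta>)) \<longlongrightarrow> h u + 0) F"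
    by (intro tendsto_add)
  moreover have "\<forall>\<^sub>F n in F. h (x n /\<^sub>R norm (x n)) + e (x n) /\<^sub>R (norm (x n) powr \<delta>)
      = \<phi> (x n) /\<^sub>R (norm (x n) powr \<delta>)"
    using filterlim_at_infinity_imp_eventually_ne[OF x(1), of 0]
  proof eventually_elim
    case (elim n)
    then have "h (x n) = (norm (x n) powr \<delta>) *\<^sub>R h (x n /\<^sub>R norm (x n))"
      using h(2)[OF inD[of n], of "norm (x n)"] by simp
    with elim show ?case
      by (simp add: eq[OF x(2)] scaleR_add_right)
  qed
  ultimately show ?thesis
    by (simp cong: filterlim_cong add: tendsto_cong)
qed

text \<open>Each inequality is tested at the image of the other solution; their sum contradicts
  strict monotonicity.\<close>

lemma whgvi_solution_unique:
  assumes mono: "strictly_monotone_wrt f g K"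
    and x: "whgvi_solution f g K x" and y: "whgvi_solution f g K y"
  shows "x = y"
proof (rule ccontr)
  assume "x \<noteq> y"
  then have "inner (f x - f y) (g x - g y) > 0"
    using mono x y unfolding strictly_monotone_wrt_def whgvi_solution_def by blast
  moreover have "inner (f x) (g y - g x) \<ge> 0" "inner (f y) (g x - g y) \<ge> 0"
    using x y unfolding whgvi_solution_def by blast+
  ultimately show False
    by (simp add: inner_diff_left inner_diff_right)
qed

lemma whgvi_truncated_solution:
  fixes f g :: "'a::euclidean_space \<Rightarrow> 'a"
  assumes K: "closed K" "convex K" "p \<in> K"
    and f: "continuous_on (g -` K) f" and g: "continuous_on UNIV g" "inj g" "K \<subseteq> range g"
    and R: "R \<ge> 0"
  obtains x where "whgvi_solution f g (K \<inter> cball p R) x"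
proof -
  let ?S = "K \<inter> cball p R"
  \<comment> \<open>This is where invariance of domain enters.\<close>
  have inv: "continuous_on (range g) (inv g)"
    by (rule continuous_on_inverse_open) (use g in auto)
  have ginv: "g (inv g y) = y" if "y \<in> K" for y
    using g(3) that by (auto intro: f_inv_into_f)
  have "continuous_on ?S (\<lambda>y. f (inv g y))"
    by (rule continuous_on_compose2[OF f continuous_on_subset[OF inv]]) (use g(3) ginv in auto)
  moreover have "compact ?S" "convex ?S" "?S \<noteq> {}"
    using K R by (auto simp: closed_Int_compact convex_Int)
  ultimately obtain y where y: "y \<in> ?S" "\<And>z. z \<in> ?S \<Longrightarrow> inner (f (inv g y)) (z - y) \<ge> 0"
    using variational_inequality_compact by blast
  then have "whgvi_solution f g ?S (inv g y)"
    unfolding whgvi_solution_def using ginv by auto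
  then show thesis
    by (rule that)
qed

lemma filterlim_powr_at_top:
  fixes p :: real
  assumes "p > 0"
  shows "filterlim (\<lambda>x. x powr p) at_top at_top"
proof -
  have "filterlim (\<lambda>x. exp (p * ln x)) at_top at_top"
    by (intro filterlim_compose[OF exp_at_top] filterlim_tendsto_pos_mult_at_top[OF tendsto_const assms]
        ln_at_top)
  moreover have "\<forall>\<^sub>F x in at_top. exp (p * ln x) = x powr p"
    using eventually_gt_at_top[of 0] by eventually_elim (simp add: powr_def)
  ultimately show ?thesis
    by (simp cong: filterlim_cong)
qed

text \<open>By compactness \<open>g\<close> is bounded on each closed ball, so points whose images
  leave every ball must themselves leave every ball.\<close>

lemma filterlim_at_infinity_of_continuous_image:
  fixes g :: "'a::{real_normed_vector,heine_borel} \<Rightarrow> 'b::real_normed_vector"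
  assumes g: "continuous_on UNIV g" and lim: "filterlim (\<lambda>n. g (x n)) at_infinity F"
  shows "filterlim x at_infinity F"
  unfolding filterlim_at_infinity[OF order_refl]
proof (intro allI impI)
  fix r :: real
  have "compact (g ` cball 0 r)"
    by (intro compact_continuous_image continuous_on_subset[OF g] compact_cball) auto
  then have "bounded (g ` cball 0 r)"
    by (rule compact_imp_bounded)
  then obtain B where B: "\<forall>y\<in>cball 0 r. norm (g y) \<le> B"
    unfolding bounded_iff by auto
  have "\<forall>\<^sub>F n in F. B < norm (g (x n))"
    using lim by (simp add: filterlim_at_infinity_conv_norm_at_top filterlim_at_top_dense)
  then show "\<forall>\<^sub>F n in F. r \<le> norm (x n)"
    proof eventually_elim
    case (elim n)
    then have "x n \<notin> cball 0 r"
      using B linorder_not_le by blast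
    then show ?case
      by simp
  qed
qed

theorem mainTheorem4:
  fixes C K :: "'a::euclidean_space set"
    and f g f_inf g_inf :: "'a \<Rightarrow> 'a"
    and \<delta>1 \<delta>2 :: real
  assumes "closed C" "convex C" "cone C"
    and "K \<noteq> {}" "closed K" "convex K"
    and "\<delta>1 > 0" "\<delta>2 > 0"
    and "weakly_homogeneous_on C \<delta>1 f" "is_leading_term C \<delta>1 f f_inf"
    and "weakly_homogeneous_on UNIV \<delta>2 g" "is_leading_term UNIV \<delta>2 g g_inf"
    and "inj g"
    and "g -` K \<subseteq> C"
    and "\<forall>y\<in>K. \<exists>x. g x = y"
    and "strictly_monotone_wrt f g K"
    and "\<forall>x\<in>C. norm x = 1 \<and> g_inf x \<in> recession_cone K \<longrightarrow> inner (f_inf x) (g_inf x) \<noteq> 0"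
  shows "\<exists>!x. whgvi_solution f g K x"
proof -
  have contf: "continuous_on C f" and contg: "continuous_on UNIV g"
    using assms(10,12) by (blast intro: leading_term_continuous_on)+
  obtain q where q: "g q \<in> K"
    using assms(4,15) by fast
  have surj: "K \<subseteq> range g"
    using assms(15) by auto
  have "\<exists>x. whgvi_solution f g K x"
  proof (rule ccontr)
    assume nosol: "\<nexists>x. whgvi_solution f g K x"
    have "\<exists>x. whgvi_solution f g (K \<inter> cball (g q) (real n)) x" for n :: nat
      using whgvi_truncated_solution[OF assms(5,6) q continuous_on_subset[OF contf assms(14)] contg assms(13)
        surj of_nat_0_le_iff] by blast
    then obtain x where x: "\<And>n. whgvi_solution f g (K \<inter> cball (g q) (real n)) (x n)"
      by metis
    have gxK: "g (x n) \<in> K" for n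
      using x[of n] by (simp add: whgvi_solution_def)
    have far: "real n \<le> dist (g q) (g (x n))" for n
    proof (rule ccontr)
      assume "\<not> ?thesis"
      then have "inner (f (x n)) (z - g (x n)) \<ge> 0" if "z \<in> K" for z
        using variational_inequality_local_imp_global[OF assms(6) gxK _ that, of "g q" n "real n" "f (x n)"] x[of n]
        by (simp add: whgvi_solution_def)
      then show False
        using nosol gxK unfolding whgvi_solution_def by blast
    qed
    have "filterlim (\<lambda>n. norm (g (x n))) at_top sequentially"
    proof (rule filterlim_at_top_mono)
      show "filterlim (\<lambda>n. - norm (g q) + real n) at_top sequentially"
        by (rule filterlim_tendsto_add_at_top[OF tendsto_const filterlim_real_sequentially])
      have "- norm (g q) + real n \<le> norm (g (x n))" for n
        using far[of n] norm_triangle_ineq4[of "g q" "g (x n)"] by (simp add: dist_norm)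
      then show "\<forall>\<^sub>F n in sequentially. - norm (g q) + real n \<le> norm (g (x n))"
        by simp
    qed
    then have x_inf: "filterlim x at_infinity sequentially"
      by (rule filterlim_at_infinity_of_continuous_image[OF contg filterlim_norm_at_top_imp_at_infinity])
    \<comment> \<open>The closed ball, unlike the sphere, also covers \<open>x n = 0\<close>;
      \<open>norm u = 1\<close> is recovered below because \<open>z n\<close> is eventually
      nonzero.\<close>
    have "x n /\<^sub>R norm (x n) \<in> cball 0 1" for n
      by (cases "x n = 0") auto
    then obtain u r where r: "strict_mono (r :: nat \<Rightarrow> nat)"
      and u: "((\<lambda>n. x n /\<^sub>R norm (x n)) \<circ> r) \<longlonglongrightarrow> u"
      using compact_cball[of "0::'a" 1, unfolded compact_def, rule_format, of "\<lambda>n. x n /\<^sub>R norm (x n)"]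
      by blast
    define z where "z = x \<circ> r"
    have z_inf: "filterlim z at_infinity sequentially"
      unfolding z_def comp_def by (rule filterlim_compose[OF x_inf filterlim_subseq[OF r]])
    have zu: "(\<lambda>n. z n /\<^sub>R norm (z n)) \<longlonglongrightarrow> u"
      using u by (simp add: z_def comp_def)
    have zK: "g (z n) \<in> K" for n
      by (simp add: z_def gxK)
    then have zC: "z n \<in> C" for n
      using assms(14) by blast
    have z_ne: "\<forall>\<^sub>F n in sequentially. z n \<noteq> q \<and> z n \<noteq> 0"
      by (intro eventually_conj filterlim_at_infinity_imp_eventually_ne[OF z_inf])
    have uC: "u \<in> C"
      using assms(3) zC by (intro closed_sequentially[OF assms(1) _ zu]) (simp add: mem_cone)
    have "(\<lambda>n. norm (z n /\<^sub>R norm (z n))) \<longlonglongrightarrow> 1"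
      by (rule tendsto_eventually) (use z_ne in eventually_elim, simp)
    then have u1: "norm u = 1"
      using LIMSEQ_unique tendsto_norm[OF zu] by blast

    let ?a = "\<lambda>n. norm (z n) powr \<delta>1" and ?b = "\<lambda>n. norm (z n) powr \<delta>2"
    have pow_inf: "filterlim (\<lambda>n. norm (z n) powr d) at_top sequentially" if "d > 0" for d
      by (rule filterlim_compose[OF filterlim_powr_at_top[OF that] filterlim_at_infinity_imp_norm_at_top[OF z_inf]])
    have small: "(\<lambda>n. w /\<^sub>R (norm (z n) powr d)) \<longlonglongrightarrow> 0" if "d > 0" for d and w :: 'a
      using tendsto_scaleR[OF tendsto_inverse_0_at_top[OF pow_inf[OF that]] tendsto_const[of w]] by simp
    have flim: "(\<lambda>n. f (z n) /\<^sub>R ?a n) \<longlonglongrightarrow> f_inf u"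
      by (rule leading_term_tendsto[OF assms(3,10) z_inf zC zu uC])
    have glim: "(\<lambda>n. g (z n) /\<^sub>R ?b n) \<longlonglongrightarrow> g_inf u"
      by (rule leading_term_tendsto[OF _ assms(12) z_inf _ zu]) (auto simp: cone_univ)
    \<comment> \<open>Subtracting a fixed vector leaves the scaled limit unchanged, since the
      divisor tends to infinity.\<close>
    have gdiff: "(\<lambda>n. (g (z n) - g q) /\<^sub>R ?b n) \<longlonglongrightarrow> g_inf u"
      using tendsto_diff[OF glim small[OF assms(8), of "g q"]] by (simp add: scaleR_diff_right)
    have fdiff: "(\<lambda>n. (f (z n) - f q) /\<^sub>R ?a n) \<longlonglongrightarrow> f_inf u"
      using tendsto_diff[OF flim small[OF assms(7), of "f q"]] by (simp add: scaleR_diff_right)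

    \<comment> \<open>The scalars are \<open>?b n\<close> and the points of \<open>K\<close> are
      \<open>g (z n)\<close>.\<close>
    have "g_inf u \<in> recession_cone K"
      unfolding recession_cone_def using pow_inf[OF assms(8)] zK glim
      by (intro CollectI exI[of _ ?b] exI[of _ "\<lambda>n. g (z n)"]) auto
    moreover have "inner (f_inf u) (g_inf u) \<le> 0"
    proof (rule tendsto_upperbound[OF tendsto_inner[OF flim gdiff]])
      \<comment> \<open>The centre \<open>g q\<close> belongs to every truncation, so it is an
        admissible test point for every \<open>n\<close>.\<close>
      have "inner (f (z n)) (g (z n) - g q) \<le> 0" for n
        using x[of "r n"] q by (auto simp: z_def whgvi_solution_def inner_diff_right)
      then show "\<forall>\<^sub>F n in sequentially. inner (f (z n) /\<^sub>R ?a n) ((g (z n) - g q) /\<^sub>R ?b n) \<le> 0"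
        by (simp add: mult_nonneg_nonpos)
    qed simp
    \<comment> \<open>Strict positivity survives the limit only as a weak inequality. Together with
      the upper bound it forces the value 0, which (ii) excludes.\<close>
    moreover have "inner (f_inf u) (g_inf u) \<ge> 0"
    proof (rule tendsto_lowerbound[OF tendsto_inner[OF fdiff gdiff]])
      show "\<forall>\<^sub>F n in sequentially. 0 \<le> inner ((f (z n) - f q) /\<^sub>R ?a n) ((g (z n) - g q) /\<^sub>R ?b n)"
        using z_ne
      proof eventually_elim
        case (elim n)
        then have "inner (f (z n) - f q) (g (z n) - g q) > 0"
          using assms(16) zK q unfolding strictly_monotone_wrt_def by blast
        then show ?case
          by simp
      qed
    qed simp
    ultimately show False
      using assms(17) uC u1 by force
  qed
  then show ?thesis
    using whgvi_solution_unique[OF assms(16)] by blast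
qed

end
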